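(* Let $\mathcal{H}=\mathbb{R}^n$ (Euclidean space), let $m\ge1$ be an integer, and let $T_1,\ldots,T_m:\mathcal{H}\to\mathcal{H}$ be affine isometries with $\bigcap_{i=1}^m\operatorname{Fix}T_i\ne\varnothing$. Let $t\ge1$ and let $q_0,\ldots,q_t$ be integers with $q_0=0$, $q_t=m$ and $q_i-q_{i-1}\ge1$ for all $i\in\{1,\ldots,t\}$. For $i\in\{1,\ldots,t\}$ set $$\mathcal{S}_i:=\{\mathrm{Id},T_{q_{i-1}+1},T_{q_{i-1}+2},\ldots,T_{q_i}\}.$$ Let $G:\mathcal{H}\to\mathcal{H}$ be such that one of the following holds: (i) $G=CC_{\mathcal{S}_t}\circ CC_{\mathcal{S}_{t-1}}\circ\cdots\circ CC_{\mathcal{S}_1}$; (ii) $G=\sum_{i=1}^t\omega_iCC_{\mathcal{S}_i}$, where $\{\omega_i\}_{1\le i\le t}\subseteq\,]0,1]$ and $\sum_{i=1}^t\omega_i=1$. Then $\operatorname{Fix}G=\bigcap_{i=1}^m\operatorname{Fix}T_i$ and $G$ is a BAM. Moreover, there exists $\gamma\in[0,1[$ such that $$(\forall x\in\mathcal{H})(\forall k\in\mathbb{N})\quad\big\|G^kx-\mathrm{P}_{\bigcap_{i=1}^m\operatorname{Fix}T_i}x\big\|\le\gamma^k\big\|x-\mathrm{P}_{\bigcap_{i=1}^m\operatorname{Fix}T_i}x\big\|.$$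
   Context: For a nonempty closed convex set $C\subseteq\mathcal{H}$, $\mathrm{P}_C$ denotes the metric projection onto $C$. $\operatorname{Fix}G=\{x\in\mathcal{H}: Gx=x\}$. $\mathbb{N}=\{0,1,2,\ldots\}$. An isometry is a map $T$ with $\|Tx-Ty\|=\|x-y\|$ for all $x,y$. Definition (BAM). Let $G:\mathcal{H}\to\mathcal{H}$ and $\gamma\in[0,1[$. $G$ is a best approximation mapping with constant $\gamma$ ($\gamma$-BAM) if (1) $\operatorname{Fix}G$ is a nonempty closed convex subset of $\mathcal{H}$; (2) $\mathrm{P}_{\operatorname{Fix}G}G=\mathrm{P}_{\operatorname{Fix}G}$; (3) $\|Gx-\mathrm{P}_{\operatorname{Fix}G}x\|\le\gamma\|x-\mathrm{P}_{\operatorname{Fix}G}x\|$ for all $x\in\mathcal{H}$. $G$ is a BAM if it is a $\gamma$-BAM for some $\gamma\in[0,1[$. Circumcenter mapping: for a finite set $\mathcal{S}$ of affine isometries of $\mathcal{H}$ having a common fixed point, and $x\in\mathcal{H}$, $CC_{\mathcal{S}}x$ is the unique point $p$ in the affine hull of $\mathcal{S}(x)=\{Tx:T\in\mathcal{S}\}$ such that $\{\|p-Tx\|:T\in\mathcal{S}\}$ is a singleton. It is a known fact that such a point exists and is unique for every $x$, so $CC_{\mathcal{S}}:\mathcal{H}\to\mathcal{H}$ is well defined. *)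

theory Defs
  imports "HOL-Analysis.Analysis"
begin

definition Fix :: "('a \<Rightarrow> 'a) \<Rightarrow> 'a set" where
  "Fix G = {x. G x = x}"

definition isometry :: "('a::real_normed_vector \<Rightarrow> 'a) \<Rightarrow> bool" where
  "isometry T \<longleftrightarrow> (\<forall>x y. norm (T x - T y) = norm (x - y))"

definition affine_map :: "('a::real_vector \<Rightarrow> 'a) \<Rightarrow> bool" where
  "affine_map T \<longleftrightarrow>
     (\<forall>x y. \<forall>u::real. T (u *\<^sub>R x + (1 - u) *\<^sub>R y) = u *\<^sub>R T x + (1 - u) *\<^sub>R T y)"

definition affine_isometry :: "('a::real_normed_vector \<Rightarrow> 'a) \<Rightarrow> bool" where
  "affine_isometry T \<longleftrightarrow> affine_map T \<and> isometry T"

(* The metric projection onto a nonempty closed convex set C is closest_point C;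
   clause (1), nonemptiness, closedness and convexity of Fix G, makes it well defined
   in clauses (2) and (3). *)
definition BAM_with :: "real \<Rightarrow> ('a::{real_inner,heine_borel} \<Rightarrow> 'a) \<Rightarrow> bool" where
  "BAM_with \<gamma> G \<longleftrightarrow>
     0 \<le> \<gamma> \<and> \<gamma> < 1 \<and>
     (Fix G \<noteq> {} \<and> closed (Fix G) \<and> convex (Fix G)) \<and>
     closest_point (Fix G) \<circ> G = closest_point (Fix G) \<and>
     (\<forall>x. norm (G x - closest_point (Fix G) x) \<le> \<gamma> * norm (x - closest_point (Fix G) x))"

definition BAM :: "('a::{real_inner,heine_borel} \<Rightarrow> 'a) \<Rightarrow> bool" where
  "BAM G \<longleftrightarrow> (\<exists>\<gamma>. BAM_with \<gamma> G)"

(* The circumcenter mapping. The description is meaningful when S is a nonempty finite set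
   of affine isometries with a common fixed point: such a p then exists and is unique. *)
definition CC :: "('a::real_inner \<Rightarrow> 'a) set \<Rightarrow> 'a \<Rightarrow> 'a" where
  "CC S x = (THE p. p \<in> affine hull ((\<lambda>T. T x) ` S) \<and>
                    is_singleton ((\<lambda>T. norm (p - T x)) ` S))"

end

theory Submission
  imports Defs
begin

text \<open>
  For a common fixed point \<open>z\<close> of \<open>S\<close>, the point \<open>CC S x\<close> is the projection of \<open>z\<close> onto the affine
  hull of the orbit of \<open>x\<close>. Hence \<open>\<parallel>x - z\<parallel>\<^sup>2 = \<parallel>x - CC S x\<parallel>\<^sup>2 + \<parallel>CC S x - z\<parallel>\<^sup>2\<close>, and equidistance gives
  \<open>\<parallel>R x - x\<parallel> \<le> 2 \<parallel>x - CC S x\<parallel>\<close> for \<open>R \<in> S\<close>. So the decrease of the squared distance to \<open>z\<close> dominates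
  all squared displacements \<open>\<parallel>R x - x\<parallel>\<^sup>2\<close>, a property inherited by compositions and by convex
  combinations. In finite dimension the displacements in turn dominate the distance to the common
  fixed point set (a Hoffman-type bound), and this yields a linear rate without any continuity
  of the circumcenter mappings.
\<close>

section \<open>Norm identities and inequalities in inner product spaces\<close>

lemma isometryD: "isometry T \<Longrightarrow> norm (T x - T y) = norm (x - y)"
  by (simp add: isometry_def)

lemma power2_norm_add_le:
  fixes a b :: "'a::real_inner"
  shows "(norm (a + b))\<^sup>2 \<le> 2 * (norm a)\<^sup>2 + 2 * (norm b)\<^sup>2"
proof -
  have "0 \<le> (norm (a - b))\<^sup>2" by simp
  then show ?thesis by (simp add: power2_norm_eq_inner algebra_simps inner_commute)
qed

text \<open>Jensen's inequality for the squared norm: the gap between the two sides is the weighted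
  variance of the \<open>v i\<close> about their mean \<open>u\<close>.\<close>

lemma power2_norm_convex_combination_le:
  fixes v :: "'i \<Rightarrow> 'a::real_inner"
  assumes "\<And>i. i \<in> I \<Longrightarrow> 0 \<le> \<omega> i" and "sum \<omega> I = 1"
  shows "(norm (\<Sum>i\<in>I. \<omega> i *\<^sub>R v i))\<^sup>2 \<le> (\<Sum>i\<in>I. \<omega> i * (norm (v i))\<^sup>2)"
proof -
  define u where "u = (\<Sum>i\<in>I. \<omega> i *\<^sub>R v i)"
  have "0 \<le> (\<Sum>i\<in>I. \<omega> i * (norm (v i - u))\<^sup>2)"
    using assms(1) by (intro sum_nonneg) simp
  also have "\<dots> = (\<Sum>i\<in>I. \<omega> i * (norm (v i))\<^sup>2 - 2 * ((\<omega> i *\<^sub>R v i) \<bullet> u) + \<omega> i * (norm u)\<^sup>2)"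
    by (intro sum.cong refl) (simp add: power2_norm_eq_inner algebra_simps inner_commute)
  also have "\<dots> = (\<Sum>i\<in>I. \<omega> i * (norm (v i))\<^sup>2) - 2 * (u \<bullet> u) + sum \<omega> I * (norm u)\<^sup>2"
    by (simp add: sum.distrib sum_subtractf sum_distrib_left sum_distrib_right inner_sum_left u_def)
  also have "\<dots> = (\<Sum>i\<in>I. \<omega> i * (norm (v i))\<^sup>2) - (norm u)\<^sup>2"
    using assms(2) by (simp add: power2_norm_eq_inner)
  finally show ?thesis by (simp add: u_def)
qed

section \<open>Circumcenters as projections of a common fixed point\<close>

lemma closest_point_affine_orthogonal:
  fixes A :: "'a::euclidean_space set"
  assumes "affine A" "closed A" "A \<noteq> {}" "y \<in> A"
  shows "(z - closest_point A z) \<bullet> (y - closest_point A z) = 0"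
proof (rule antisym)
  let ?p = "closest_point A z"
  have p: "?p \<in> A" using assms by (simp add: closest_point_in_set)
  have le: "(z - ?p) \<bullet> (w - ?p) \<le> 0" if "w \<in> A" for w
    using closest_point_dot assms affine_imp_convex that by blast
  show "(z - ?p) \<bullet> (y - ?p) \<le> 0" using le assms by blast
  \<comment> \<open>The reflection of \<open>y\<close> in \<open>?p\<close> stays in the affine set,
    so the obtuse-angle inequality also holds with the opposite sign.\<close>
  have "2 *\<^sub>R ?p + (-1) *\<^sub>R y \<in> A"
    using mem_affine[OF assms(1) p assms(4), of 2 "-1"] by simp
  from le[OF this] show "0 \<le> (z - ?p) \<bullet> (y - ?p)"
    by (simp add: algebra_simps scaleR_2)
qed

text \<open>Every \<open>R x\<close> has distance \<open>norm (x - z)\<close> from \<open>z\<close>.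
  By Pythagoras the projection of \<open>z\<close> onto the hull is therefore equidistant from all
  \<open>R x\<close>, which gives existence.\<close>

lemma CC_eq_closest_point:
  fixes S :: "('a::euclidean_space \<Rightarrow> 'a) set"
  assumes "finite S" "S \<noteq> {}" "\<And>R. R \<in> S \<Longrightarrow> isometry R" "\<And>R. R \<in> S \<Longrightarrow> R z = z"
  shows "CC S x = closest_point (affine hull ((\<lambda>R. R x) ` S)) z"
    and "\<And>R R'. R \<in> S \<Longrightarrow> R' \<in> S \<Longrightarrow> norm (CC S x - R x) = norm (CC S x - R' x)"
proof -
  let ?O = "(\<lambda>R. R x) ` S"
  let ?A = "affine hull ?O"
  define p where "p = closest_point ?A z"
  have A: "affine ?A" "closed ?A" "?A \<noteq> {}" using assms(2) by auto
  have pA: "p \<in> ?A" unfolding p_def using A by (intro closest_point_in_set)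
  have orth: "(z - p) \<bullet> (y - p) = 0" if "y \<in> ?A" for y
    unfolding p_def using A that by (rule closest_point_affine_orthogonal)
  have eq: "(norm (p - R x))\<^sup>2 = (norm (x - z))\<^sup>2 - (norm (z - p))\<^sup>2" if "R \<in> S" for R
  proof -
    have "R x \<in> ?A" using that by (simp add: hull_inc)
    from orth[OF this] have "(norm (R x - z))\<^sup>2 = (norm (p - R x))\<^sup>2 + (norm (z - p))\<^sup>2"
      by (simp add: power2_norm_eq_inner algebra_simps inner_commute)
    moreover have "norm (R x - z) = norm (x - z)"
      using isometryD[OF assms(3)[OF that], of x z] assms(4)[OF that] by simp
    ultimately show ?thesis by simp
  qed
  have equid: "norm (p - R x) = norm (p - R' x)" if "R \<in> S" "R' \<in> S" for R R'
    using eq[OF that(1)] eq[OF that(2)] by (metis norm_ge_zero power2_eq_imp_eq)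
  obtain R0 where R0: "R0 \<in> S" using assms(2) by auto
  have "(\<lambda>R. norm (p - R x)) ` S = (\<lambda>R. norm (p - R0 x)) ` S"
    by (rule image_cong[OF refl]) (rule equid[OF _ R0])
  then have sing: "is_singleton ((\<lambda>R. norm (p - R x)) ` S)"
    using assms(2) by (simp add: is_singleton_def image_constant_conv)
  have uniq: "p' = p" if p': "p' \<in> ?A" and sing': "is_singleton ((\<lambda>R. norm (p' - R x)) ` S)" for p'
  proof -
    have "norm (p' - R x) = norm (p' - R0 x)" if "R \<in> S" for R
      using sing' R0 that unfolding is_singleton_def by (metis imageI singletonD)
    then have sq: "(norm (p' - R x))\<^sup>2 - (norm (p - R x))\<^sup>2
        = (norm (p' - R0 x))\<^sup>2 - (norm (p - R0 x))\<^sup>2" if "R \<in> S" for R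
      using equid[OF that R0] that by simp
    \<comment> \<open>Subtracting the squared distances to \<open>p\<close> from those to
      \<open>p'\<close> cancels the term quadratic in \<open>R x\<close>. The orbit thus lies in a
      hyperplane normal to \<open>p' - p\<close>; its hull contains both points, which forces
      \<open>p' = p\<close>.\<close>
    define c where "c = (p' - p) \<bullet> R0 x"
    have "(p' - p) \<bullet> R x = c" if "R \<in> S" for R
      using sq[OF that] by (simp add: c_def power2_norm_eq_inner algebra_simps inner_commute)
    then have "?O \<subseteq> {y. (p' - p) \<bullet> y = c}" by auto
    then have "?A \<subseteq> {y. (p' - p) \<bullet> y = c}"
      by (rule hull_minimal) (rule affine_hyperplane)
    then have "(p' - p) \<bullet> p' = c" "(p' - p) \<bullet> p = c" using p' pA by auto
    then have "(p' - p) \<bullet> (p' - p) = 0" by (simp add: inner_diff_right)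
    then show ?thesis by simp
  qed
  have CC: "CC S x = p"
    unfolding CC_def
  proof (rule the_equality)
    show "p \<in> ?A \<and> is_singleton ((\<lambda>R. norm (p - R x)) ` S)" using pA sing ..
  qed (elim conjE, rule uniq)
  then show "CC S x = closest_point ?A z" by (simp add: p_def)
  show "norm (CC S x - R x) = norm (CC S x - R' x)" if "R \<in> S" "R' \<in> S" for R R'
    unfolding CC using that by (rule equid)
qed

lemma CC_pythagoras:
  fixes S :: "('a::euclidean_space \<Rightarrow> 'a) set"
  assumes "finite S" "id \<in> S" "\<And>R. R \<in> S \<Longrightarrow> isometry R" "\<And>R. R \<in> S \<Longrightarrow> R z = z"
  shows "(norm (x - z))\<^sup>2 = (norm (x - CC S x))\<^sup>2 + (norm (CC S x - z))\<^sup>2"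
proof -
  let ?A = "affine hull ((\<lambda>R. R x) ` S)"
  have "x \<in> ?A" using assms(2) by (intro hull_inc) (metis id_apply imageI)
  moreover have "CC S x = closest_point ?A z" using assms by (intro CC_eq_closest_point) auto
  ultimately have "(z - CC S x) \<bullet> (x - CC S x) = 0"
    by (auto intro!: closest_point_affine_orthogonal)
  then show ?thesis
    by (simp add: power2_norm_eq_inner algebra_simps inner_commute)
qed

section \<open>Mappings whose decrease in squared distance dominates displacements\<close>

text \<open>The orthogonality clause serves to preserve projections onto \<open>F\<close>; the bound
  is a quantitative Fejer property, with \<open>K\<close> uniform in \<open>x\<close> and
  \<open>z\<close> so that a linear rate can follow. Including \<open>G\<close> among the controlled
  maps makes the decrease nonnegative and lets a composition compare \<open>x\<close> with
  \<open>G x\<close>.\<close>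

definition controls ::
    "'a::real_inner set \<Rightarrow> ('a \<Rightarrow> 'a) set \<Rightarrow> ('a \<Rightarrow> 'a) \<Rightarrow> bool" where
  "controls F J G \<longleftrightarrow>
     (\<forall>x. \<forall>z\<in>F. \<forall>w\<in>F. (x - G x) \<bullet> (z - w) = 0) \<and>
     (\<exists>K>0. \<forall>x. \<forall>z\<in>F. \<forall>R\<in>insert G J.
        (norm (R x - x))\<^sup>2 \<le> K * ((norm (x - z))\<^sup>2 - (norm (G x - z))\<^sup>2))"

lemma controls_orthogonal:
  "controls F J G \<Longrightarrow> z \<in> F \<Longrightarrow> w \<in> F \<Longrightarrow> (x - G x) \<bullet> (z - w) = 0"
  by (simp add: controls_def)

lemma controls_bound:
  assumes "controls F J G"
  obtains K where "K > 0"
    "\<And>x z R. z \<in> F \<Longrightarrow> R \<in> insert G J \<Longrightarrow>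
       (norm (R x - x))\<^sup>2 \<le> K * ((norm (x - z))\<^sup>2 - (norm (G x - z))\<^sup>2)"
  using assms unfolding controls_def by blast

lemma controls_fejer:
  assumes "controls F J G" "z \<in> F"
  shows "0 \<le> (norm (x - z))\<^sup>2 - (norm (G x - z))\<^sup>2"
proof -
  obtain K where K: "K > 0"
    "(norm (G x - x))\<^sup>2 \<le> K * ((norm (x - z))\<^sup>2 - (norm (G x - z))\<^sup>2)"
    using controls_bound[OF assms(1)] assms(2) by (metis insertI1)
  from K(2) have "0 \<le> K * ((norm (x - z))\<^sup>2 - (norm (G x - z))\<^sup>2)"
    using zero_le_power2 order_trans by blast
  with K(1) show ?thesis by (simp add: zero_le_mult_iff)
qed

lemma controls_id: "controls F {} id"
  unfolding controls_def by (auto intro: exI[of _ 1])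

lemma controls_CC:
  fixes S :: "('a::euclidean_space \<Rightarrow> 'a) set"
  assumes "finite S" "id \<in> S" "\<And>R. R \<in> S \<Longrightarrow> isometry R" "\<And>R z. R \<in> S \<Longrightarrow> z \<in> F \<Longrightarrow> R z = z"
  shows "controls F S (CC S)"
  unfolding controls_def
proof (intro conjI allI ballI)
  note pyth = CC_pythagoras[OF assms(1-3)]
  \<comment> \<open>By Pythagoras the decrease equals \<open>(norm (x - CC S x))\<^sup>2\<close> for
    every \<open>z \<in> F\<close>; equating it for \<open>z\<close> and \<open>w\<close> leaves
    only the inner product.\<close>
  show "(x - CC S x) \<bullet> (z - w) = 0" if "z \<in> F" "w \<in> F" for x z w
    using pyth[of z x] pyth[of w x] that assms(4)
    by (simp add: power2_norm_eq_inner algebra_simps inner_commute)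
  \<comment> \<open>The factor 4 is the square of the 2 from the triangle inequality through
    \<open>CC S x\<close>, which is equally far from \<open>R x\<close> and
    \<open>id x\<close>.\<close>
  have "(norm (R x - x))\<^sup>2 \<le> 4 * ((norm (x - z))\<^sup>2 - (norm (CC S x - z))\<^sup>2)"
    if "z \<in> F" "R \<in> insert (CC S) S" for x z R
  proof -
    have "norm (R x - x) \<le> 2 * norm (x - CC S x)"
    proof (cases "R = CC S")
      case True
      then show ?thesis by (simp add: norm_minus_commute)
    next
      case False
      have "norm (CC S x - R x) = norm (CC S x - id x)"
        using CC_eq_closest_point(2)[of S z R id x] assms that False by auto
      then show ?thesis
        using norm_triangle_ineq[of "R x - CC S x" "CC S x - x"]
        by (simp add: norm_minus_commute)
    qed
    then have "(norm (R x - x))\<^sup>2 \<le> (2 * norm (x - CC S x))\<^sup>2"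
      by (rule power_mono) simp
    also have "\<dots> = 4 * ((norm (x - z))\<^sup>2 - (norm (CC S x - z))\<^sup>2)"
      using pyth[of z x] that assms(4) by (simp add: power_mult_distrib)
    finally show ?thesis .
  qed
  then show "\<exists>K>0. \<forall>x. \<forall>z\<in>F. \<forall>R\<in>insert (CC S) S.
      (norm (R x - x))\<^sup>2 \<le> K * ((norm (x - z))\<^sup>2 - (norm (CC S x - z))\<^sup>2)"
    by (intro exI[of _ 4]) auto
qed

text \<open>The decreases of the two stages add up. Displacements under \<open>R \<in> L\<close> are
  controlled at \<open>G x\<close>; the isometry property carries them back to \<open>x\<close> at
  the cost of \<open>2 * norm (G x - x)\<close>.\<close>

lemma controls_comp:
  assumes G: "controls F J G" and H: "controls F L H"
    and iso: "\<And>R. R \<in> L \<Longrightarrow> isometry R"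
  shows "controls F (J \<union> L) (H \<circ> G)"
proof -
  obtain K where K: "K > 0" "\<And>x z R. z \<in> F \<Longrightarrow> R \<in> insert G J \<Longrightarrow>
      (norm (R x - x))\<^sup>2 \<le> K * ((norm (x - z))\<^sup>2 - (norm (G x - z))\<^sup>2)"
    using controls_bound[OF G] by blast
  obtain M where M: "M > 0" "\<And>x z R. z \<in> F \<Longrightarrow> R \<in> insert H L \<Longrightarrow>
      (norm (R x - x))\<^sup>2 \<le> M * ((norm (x - z))\<^sup>2 - (norm (H x - z))\<^sup>2)"
    using controls_bound[OF H] by blast
  show ?thesis
    unfolding controls_def
  proof (intro conjI allI ballI)
    show "(x - (H \<circ> G) x) \<bullet> (z - w) = 0" if "z \<in> F" "w \<in> F" for x z w
      using controls_orthogonal[OF G that, of x] controls_orthogonal[OF H that, of "G x"]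
      by (simp add: inner_diff_left)
    have "(norm (R x - x))\<^sup>2
        \<le> (8 * K + 2 * M) * ((norm (x - z))\<^sup>2 - (norm ((H \<circ> G) x - z))\<^sup>2)"
      if z: "z \<in> F" and R: "R \<in> insert (H \<circ> G) (J \<union> L)" for x z R
    proof -
      define d e where "d = (norm (x - z))\<^sup>2 - (norm (G x - z))\<^sup>2"
        and "e = (norm (G x - z))\<^sup>2 - (norm (H (G x) - z))\<^sup>2"
      have de: "0 \<le> d" "0 \<le> e"
        unfolding d_def e_def using controls_fejer[OF G z] controls_fejer[OF H z] by auto
      have Gx: "(norm (G x - x))\<^sup>2 \<le> K * d" using K(2)[OF z, of G x] by (simp add: d_def)
      consider "R = H \<circ> G" | "R \<in> J" | "R \<in> L" using R by auto
      \<comment> \<open>The third case dictates the constants: squaring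
        \<open>2 * norm (G x - x)\<close> gives 4, and \<open>power2_norm_add_le\<close> doubles
        both terms.\<close>
      then have "(norm (R x - x))\<^sup>2 \<le> 8 * (K * d) + 2 * (M * e)"
      proof cases
        case 1
        have "(norm (H (G x) - G x))\<^sup>2 \<le> M * e" using M(2)[OF z, of H "G x"] by (simp add: e_def)
        moreover have "0 \<le> K * d" using K(1) de by simp
        ultimately show ?thesis
          using 1 Gx power2_norm_add_le[of "H (G x) - G x" "G x - x"] by simp
      next
        case 2
        have "(norm (R x - x))\<^sup>2 \<le> K * d" using K(2)[OF z, of R x] 2 by (simp add: d_def)
        moreover have "0 \<le> K * d" "0 \<le> M * e" using K(1) M(1) de by simp_all
        ultimately show ?thesis by simp
      next
        case 3
        have "norm (R x - R (G x)) = norm (G x - x)"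
          using isometryD[OF iso[OF 3], of x "G x"] by (simp add: norm_minus_commute)
        then have "norm ((R x - R (G x)) + (G x - x)) \<le> 2 * norm (G x - x)"
          using norm_triangle_ineq[of "R x - R (G x)" "G x - x"] by simp
        then have "(norm ((R x - R (G x)) + (G x - x)))\<^sup>2 \<le> (2 * norm (G x - x))\<^sup>2"
          by (rule power_mono) simp
        moreover have "(norm (R (G x) - G x))\<^sup>2 \<le> M * e"
          using M(2)[OF z, of R "G x"] 3 by (simp add: e_def)
        ultimately show ?thesis
          using Gx power2_norm_add_le[of "(R x - R (G x)) + (G x - x)" "R (G x) - G x"]
          by (simp add: power_mult_distrib algebra_simps)
      qed
      also have "\<dots> \<le> (8 * K + 2 * M) * (d + e)"
        using K(1) M(1) de by (simp add: algebra_simps)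
      also have "d + e = (norm (x - z))\<^sup>2 - (norm ((H \<circ> G) x - z))\<^sup>2"
        by (simp add: d_def e_def)
      finally show ?thesis .
    qed
    then show "\<exists>C>0. \<forall>x. \<forall>z\<in>F. \<forall>R\<in>insert (H \<circ> G) (J \<union> L). (norm (R x - x))\<^sup>2
        \<le> C * ((norm (x - z))\<^sup>2 - (norm ((H \<circ> G) x - z))\<^sup>2)"
      using K(1) M(1) by (intro exI[of _ "8 * K + 2 * M"]) auto
  qed
qed

text \<open>\<open>fold\<close> puts the last list element outermost, so induction from the right
  end peels off exactly the outer factor of \<open>controls_comp\<close>.\<close>

lemma controls_fold_comp:
  assumes "\<And>i. i \<in> set is \<Longrightarrow> controls F (J i) (C i)"
    and "\<And>i R. i \<in> set is \<Longrightarrow> R \<in> J i \<Longrightarrow> isometry R"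
  shows "controls F (\<Union>i\<in>set is. J i) (fold (\<lambda>i G. C i \<circ> G) is id)"
  using assms
proof (induction "is" rule: rev_induct)
  case Nil
  then show ?case using controls_id by (simp add: id_def)
next
  case (snoc i "is")
  have "controls F ((\<Union>j\<in>set is. J j) \<union> J i) (C i \<circ> fold (\<lambda>i G. C i \<circ> G) is id)"
    using snoc.prems by (intro controls_comp snoc.IH) auto
  then show ?case by (simp add: Un_commute id_def comp_def)
qed

text \<open>Convexity of the squared norm bounds the weighted average of the individual decreases by
  the decrease of the combination. Each individual decrease is nonnegative, so dividing by its
  positive weight recovers it.\<close>

lemma controls_convex_combination:
  assumes I: "finite I" and C: "\<And>i. i \<in> I \<Longrightarrow> controls F (J i) (C i)"
    and pos: "\<And>i. i \<in> I \<Longrightarrow> 0 < \<omega> i" and one: "sum \<omega> I = 1"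
  shows "controls F (\<Union>i\<in>I. J i) (\<lambda>x. \<Sum>i\<in>I. \<omega> i *\<^sub>R C i x)" (is "controls F _ ?G")
proof -
  have "\<forall>i\<in>I. \<exists>K>0. \<forall>x. \<forall>z\<in>F. \<forall>R\<in>insert (C i) (J i).
      (norm (R x - x))\<^sup>2 \<le> K * ((norm (x - z))\<^sup>2 - (norm (C i x - z))\<^sup>2)"
    using C unfolding controls_def by blast
  then obtain K where K0: "\<And>i. i \<in> I \<Longrightarrow> K i > 0"
    and K: "\<And>i x z R. i \<in> I \<Longrightarrow> z \<in> F \<Longrightarrow> R \<in> insert (C i) (J i) \<Longrightarrow>
      (norm (R x - x))\<^sup>2 \<le> K i * ((norm (x - z))\<^sup>2 - (norm (C i x - z))\<^sup>2)"
    by (metis (no_types, lifting))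
  \<comment> \<open>A sum of positive terms, hence a common upper bound for all the ratios
    \<open>K i / \<omega> i\<close>.\<close>
  define M where "M = (\<Sum>i\<in>I. K i / \<omega> i)"
  have "I \<noteq> {}" using one by auto
  then have M0: "M > 0" unfolding M_def using I K0 pos by (intro sum_pos) auto
  have diff: "?G x - y = (\<Sum>i\<in>I. \<omega> i *\<^sub>R (C i x - y))" for x y
    by (simp add: scaleR_diff_right sum_subtractf one flip: scaleR_left.sum)
  show ?thesis
    unfolding controls_def
  proof (intro conjI allI ballI)
    show "(x - ?G x) \<bullet> (z - w) = 0" if "z \<in> F" "w \<in> F" for x z w
    proof -
      have "(?G x - x) \<bullet> (z - w) = (\<Sum>i\<in>I. \<omega> i * - ((x - C i x) \<bullet> (z - w)))"
        unfolding diff inner_sum_left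
        by (intro sum.cong refl) (simp add: inner_diff_left algebra_simps)
      also have "\<dots> = 0"
        using controls_orthogonal[OF C that] by (intro sum.neutral) auto
      finally show ?thesis by (simp add: inner_diff_left)
    qed
    have bound: "(norm (R x - x))\<^sup>2 \<le> M * ((norm (x - z))\<^sup>2 - (norm (?G x - z))\<^sup>2)"
      if i: "i \<in> I" and z: "z \<in> F" and R: "R \<in> insert (C i) (J i)" for i x z R
    proof -
      define d where "d i = (norm (x - z))\<^sup>2 - (norm (C i x - z))\<^sup>2" for i
      have d0: "0 \<le> d j" if "j \<in> I" for j
        unfolding d_def using controls_fejer[OF C[OF that] z] .
      have "\<omega> i * d i \<le> (\<Sum>j\<in>I. \<omega> j * d j)"
        using i I d0 pos by (intro member_le_sum) (auto simp: less_imp_le)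
      also have "\<dots> = (norm (x - z))\<^sup>2 - (\<Sum>j\<in>I. \<omega> j * (norm (C j x - z))\<^sup>2)"
        by (simp add: d_def right_diff_distrib sum_subtractf one flip: sum_distrib_right)
      also have "\<dots> \<le> (norm (x - z))\<^sup>2 - (norm (?G x - z))\<^sup>2"
        unfolding diff using power2_norm_convex_combination_le[of I \<omega> "\<lambda>j. C j x - z"] pos one
        by (simp add: less_imp_le)
      finally have D: "\<omega> i * d i \<le> (norm (x - z))\<^sup>2 - (norm (?G x - z))\<^sup>2" .
      have "(norm (R x - x))\<^sup>2 \<le> K i / \<omega> i * (\<omega> i * d i)"
        using K[OF i z R] pos[OF i] by (simp add: d_def)
      also have "\<dots> \<le> M * (\<omega> i * d i)"
        unfolding M_def using i I K0 pos d0[OF i]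
        by (intro mult_right_mono member_le_sum) (auto simp: less_imp_le)
      also have "\<dots> \<le> M * ((norm (x - z))\<^sup>2 - (norm (?G x - z))\<^sup>2)"
        using D M0 by (intro mult_left_mono) auto
      finally show ?thesis .
    qed
    \<comment> \<open>Jensen's inequality reduces the displacement of the combination to the case
      \<open>R = C i\<close> of \<open>bound\<close>.\<close>
    have boundG: "(norm (?G x - x))\<^sup>2 \<le> M * ((norm (x - z))\<^sup>2 - (norm (?G x - z))\<^sup>2)"
      if z: "z \<in> F" for x z
    proof -
      have "(norm (?G x - x))\<^sup>2 \<le> (\<Sum>i\<in>I. \<omega> i * (norm (C i x - x))\<^sup>2)"
        unfolding diff using pos one
        by (intro power2_norm_convex_combination_le) (auto simp: less_imp_le)
      also have "\<dots> \<le> (\<Sum>i\<in>I. \<omega> i * (M * ((norm (x - z))\<^sup>2 - (norm (?G x - z))\<^sup>2)))"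
        using bound[OF _ z] pos by (intro sum_mono mult_left_mono) (auto simp: less_imp_le)
      finally show ?thesis using one by (simp flip: sum_distrib_right)
    qed
    show "\<exists>K>0. \<forall>x. \<forall>z\<in>F. \<forall>R\<in>insert ?G (\<Union>i\<in>I. J i).
        (norm (R x - x))\<^sup>2 \<le> K * ((norm (x - z))\<^sup>2 - (norm (?G x - z))\<^sup>2)"
      using M0 bound boundG by (intro exI[of _ M]) blast
  qed
qed

section \<open>Error bound for the common fixed point set\<close>

lemma affine_map_linear_part:
  assumes T: "affine_map T" and "T a = a"
  shows "linear (\<lambda>v. T (a + v) - a)"
proof -
  have scale: "T (a + u *\<^sub>R v) - a = u *\<^sub>R (T (a + v) - a)" for u v
  proof -
    have "a + u *\<^sub>R v = u *\<^sub>R (a + v) + (1 - u) *\<^sub>R a" by (simp add: algebra_simps)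
    then have "T (a + u *\<^sub>R v) = u *\<^sub>R T (a + v) + (1 - u) *\<^sub>R T a"
      using T unfolding affine_map_def by metis
    then show ?thesis using assms(2) by (simp add: algebra_simps)
  qed
  \<comment> \<open>Affinity only handles weights summing to 1, so additivity is obtained at the
    midpoint of \<open>a + v\<close> and \<open>a + w\<close> and then doubled by
    homogeneity.\<close>
  have "T (a + (v + w)) - a = (T (a + v) - a) + (T (a + w) - a)" for v w
  proof -
    have "a + (1/2) *\<^sub>R (v + w) = (1/2) *\<^sub>R (a + v) + (1 - 1/2) *\<^sub>R (a + w)"
      by (simp add: scaleR_add_right flip: scaleR_left_distrib)
    then have mid: "T (a + (1/2) *\<^sub>R (v + w)) = (1/2) *\<^sub>R T (a + v) + (1 - 1/2) *\<^sub>R T (a + w)"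
      using T unfolding affine_map_def by metis
    have "T (a + (v + w)) - a = 2 *\<^sub>R (T (a + (1/2) *\<^sub>R (v + w)) - a)"
      unfolding scale by simp
    then show ?thesis unfolding mid by (simp add: scaleR_add_right scaleR_diff_right scaleR_2)
  qed
  then show ?thesis using scale by (rule linearI)
qed

text \<open>Translated by a common fixed point \<open>a\<close>, the displacements sum to one linear
  map \<open>f\<close> whose kernel consists of directions to common fixed points. A bounded
  correction moves any point into that kernel.\<close>

lemma common_fixed_points_regular:
  fixes J :: "('a::euclidean_space \<Rightarrow> 'a) set"
  assumes J: "finite J" "\<And>R. R \<in> J \<Longrightarrow> affine_isometry R" and ne: "(\<Inter>R\<in>J. Fix R) \<noteq> {}"
  obtains B where "B \<ge> 0"
    "\<And>x. \<exists>w\<in>(\<Inter>R\<in>J. Fix R). norm (x - w) \<le> B * (\<Sum>R\<in>J. norm (R x - x))"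
proof -
  obtain a where a: "\<And>R. R \<in> J \<Longrightarrow> R a = a" using ne by (auto simp: Fix_def)
  define f where "f v = (\<Sum>R\<in>J. v - (R (a + v) - a))" for v
  have lin: "linear f"
    unfolding f_def using J(2) a
    by (intro linear_compose_sum ballI linear_compose_sub linear_ident affine_map_linear_part)
      (auto simp: affine_isometry_def)
  \<comment> \<open>An isometry \<open>L\<close> with \<open>L 0 = 0\<close> satisfies \<open>2 v \<bullet> (v - L v) = \<parallel>v - L v\<parallel>\<^sup>2\<close>, so no
    cancellation can occur in \<open>v \<bullet> f v\<close>.\<close>
  have ker: "a + v \<in> (\<Inter>R\<in>J. Fix R)" if "f v = 0" for v
  proof -
    have "v \<bullet> (v - (R (a + v) - a)) = (norm (v - (R (a + v) - a)))\<^sup>2 / 2" if "R \<in> J" for R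
    proof -
      have "norm (R (a + v) - a) = norm v"
        using isometryD[of R "a + v" a] J(2)[OF that] a[OF that]
        by (simp add: affine_isometry_def)
      then have "(norm (R (a + v) - a))\<^sup>2 = (norm v)\<^sup>2" by simp
      then show ?thesis
        unfolding power2_norm_eq_inner
        by (simp only: inner_diff_left inner_diff_right inner_commute) simp
    qed
    then have "v \<bullet> f v = (\<Sum>R\<in>J. (norm (v - (R (a + v) - a)))\<^sup>2 / 2)"
      unfolding f_def inner_sum_right by (intro sum.cong) auto
    then have "(\<Sum>R\<in>J. (norm (v - (R (a + v) - a)))\<^sup>2 / 2) = 0" using that by simp
    then have "\<forall>R\<in>J. (norm (v - (R (a + v) - a)))\<^sup>2 / 2 = 0"
      using J(1) by (subst (asm) sum_nonneg_eq_0_iff) auto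
    then show ?thesis by (auto simp: Fix_def algebra_simps)
  qed
  \<comment> \<open>\<open>g\<close> is a generalized inverse: \<open>v - g (f v)\<close> lies in
    the kernel of \<open>f\<close>, and the correction \<open>g (f v)\<close> has norm at most a
    constant times \<open>norm (f v)\<close>.\<close>
  obtain g where g: "linear g" "\<And>v. f (g (f v)) = f v"
    using linear_exists_right_inverse_on[OF lin subspace_UNIV] by auto
  obtain B where B: "B > 0" "\<And>v. norm (g v) \<le> B * norm v"
    using linear_bounded_pos[OF g(1)] by auto
  show thesis
  proof (rule that)
    show "0 \<le> B" using B(1) by simp
    fix x
    let ?w = "a + ((x - a) - g (f (x - a)))"
    have "f ((x - a) - g (f (x - a))) = 0"
      using linear_diff[OF lin, of "x - a" "g (f (x - a))"] g(2)[of "x - a"] by simp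
    then have "?w \<in> (\<Inter>R\<in>J. Fix R)" by (rule ker)
    moreover have "norm (x - ?w) \<le> B * (\<Sum>R\<in>J. norm (R x - x))"
    proof -
      have "norm (x - ?w) \<le> B * norm (f (x - a))" using B(2) by simp
      also have "norm (f (x - a)) \<le> (\<Sum>R\<in>J. norm (R x - x))"
        unfolding f_def by (rule norm_sum[THEN order_trans]) (simp add: norm_minus_commute)
      finally show ?thesis using B(1) by simp
    qed
    ultimately show "\<exists>w\<in>(\<Inter>R\<in>J. Fix R). norm (x - w) \<le> B * (\<Sum>R\<in>J. norm (R x - x))" by blast
  qed
qed

section \<open>Fixed points, preserved projections and the linear rate\<close>

lemma convex_Fix_affine_map:
  fixes R :: "'a::real_vector \<Rightarrow> 'a"
  shows "affine_map R \<Longrightarrow> convex (Fix R)"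
  unfolding convex_alt
proof (intro ballI allI impI)
  fix x y :: 'a and u :: real
  assume R: "affine_map R" and "x \<in> Fix R" "y \<in> Fix R"
  moreover have "R (u *\<^sub>R y + (1 - u) *\<^sub>R x) = u *\<^sub>R R y + (1 - u) *\<^sub>R R x"
    using R unfolding affine_map_def by blast
  ultimately show "(1 - u) *\<^sub>R x + u *\<^sub>R y \<in> Fix R"
    by (simp add: Fix_def add.commute)
qed

lemma closed_Fix_isometry: "isometry R \<Longrightarrow> closed (Fix R)"
proof -
  assume "isometry R"
  then have "continuous_on UNIV R"
    by (auto simp: continuous_on_iff dist_norm isometry_def)
  then show ?thesis unfolding Fix_def by (intro closed_Collect_eq continuous_on_id)
qed

text \<open>At a fixed point of \<open>G\<close> the decrease is zero, so every displacement under
  \<open>J\<close> vanishes. Conversely, a point of \<open>F\<close> may itself serve as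
  \<open>z\<close> in the Fejer inequality.\<close>

lemma Fix_controls:
  assumes F: "F = (\<Inter>R\<in>J. Fix R)" "F \<noteq> {}" and G: "controls F J G"
  shows "Fix G = F"
proof (rule set_eqI)
  fix x
  obtain K where "K > 0" and K: "\<And>x z R. z \<in> F \<Longrightarrow> R \<in> insert G J \<Longrightarrow>
      (norm (R x - x))\<^sup>2 \<le> K * ((norm (x - z))\<^sup>2 - (norm (G x - z))\<^sup>2)"
    using controls_bound[OF G] by blast
  obtain z where "z \<in> F" using F(2) by blast
  show "x \<in> Fix G \<longleftrightarrow> x \<in> F"
  proof
    assume "x \<in> Fix G"
    then have "(norm (R x - x))\<^sup>2 \<le> 0" if "R \<in> J" for R
      using K[OF \<open>z \<in> F\<close>, of R x] that by (simp add: Fix_def)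
    then show "x \<in> F" by (simp add: F(1) Fix_def)
  next
    assume "x \<in> F"
    from controls_fejer[OF G this, of x] show "x \<in> Fix G" by (simp add: Fix_def)
  qed
qed

text \<open>\<open>G x - ?p\<close> and \<open>x - ?p\<close> differ by a vector orthogonal to all
  differences of points of \<open>F\<close>, so the variational inequality characterizing the
  projection carries over from \<open>x\<close> to \<open>G x\<close>.\<close>

lemma closest_point_controls:
  fixes F :: "'a::euclidean_space set"
  assumes F: "convex F" "closed F" "F \<noteq> {}" and G: "controls F J G"
  shows "closest_point F (G x) = closest_point F x"
proof -
  let ?p = "closest_point F x"
  have p: "?p \<in> F" using F by (simp add: closest_point_in_set)
  have "dist (G x) ?p \<le> dist (G x) z" if z: "z \<in> F" for z
  proof -
    have "(x - ?p) \<bullet> (z - ?p) \<le> 0" using closest_point_dot F z by blast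
    with controls_orthogonal[OF G z p, of x] have "(G x - ?p) \<bullet> (z - ?p) \<le> 0"
      by (simp add: inner_diff_left)
    moreover have "(norm (G x - z))\<^sup>2
        = (norm (G x - ?p))\<^sup>2 - 2 * ((G x - ?p) \<bullet> (z - ?p)) + (norm (z - ?p))\<^sup>2"
      by (simp add: power2_norm_eq_inner algebra_simps inner_commute)
    ultimately have "(norm (G x - ?p))\<^sup>2 \<le> (norm (G x - z))\<^sup>2"
      using zero_le_power2[of "norm (z - ?p)"] by linarith
    then show ?thesis by (simp add: dist_norm)
  qed
  then show ?thesis using closest_point_unique[OF F(1,2) p] by simp
qed

lemma controls_linear_rate:
  fixes J :: "('a::euclidean_space \<Rightarrow> 'a) set"
  assumes J: "finite J" "\<And>R. R \<in> J \<Longrightarrow> affine_isometry R"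
    and F: "F = (\<Inter>R\<in>J. Fix R)" "F \<noteq> {}" and G: "controls F J G"
  obtains \<gamma> where "BAM_with \<gamma> G"
    "\<And>x k. norm ((G ^^ k) x - closest_point F x) \<le> \<gamma> ^ k * norm (x - closest_point F x)"
proof -
  have cF: "convex F" "closed F"
    using J(2) unfolding F(1)
    by (auto simp: affine_isometry_def intro!: convex_INT closed_INT convex_Fix_affine_map
        closed_Fix_isometry)
  note pG = closest_point_controls[OF cF F(2) G]
  obtain B where B: "B \<ge> 0" "\<And>x. \<exists>w\<in>F. norm (x - w) \<le> B * (\<Sum>R\<in>J. norm (R x - x))"
    using common_fixed_points_regular[OF J] F by metis
  obtain K where K: "K > 0" "\<And>x z R. z \<in> F \<Longrightarrow> R \<in> insert G J \<Longrightarrow>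
      (norm (R x - x))\<^sup>2 \<le> K * ((norm (x - z))\<^sup>2 - (norm (G x - z))\<^sup>2)"
    using controls_bound[OF G] by blast
  \<comment> \<open>The summand \<open>1\<close> guarantees \<open>M \<ge> 1\<close>, so that \<open>1 - 1 / M\<close> has a real square root.\<close>
  define M where "M = 1 + B\<^sup>2 * (card J)\<^sup>2 * K"
  have M1: "M \<ge> 1" unfolding M_def using K(1) by simp
  define \<gamma> where "\<gamma> = sqrt (1 - 1 / M)"
  have \<gamma>: "0 \<le> \<gamma>" "\<gamma> < 1" unfolding \<gamma>_def using M1 by auto
  have contr: "norm (G x - closest_point F x) \<le> \<gamma> * norm (x - closest_point F x)" for x
  proof -
    define p where "p = closest_point F x"
    have p: "p \<in> F" unfolding p_def using cF F(2) by (simp add: closest_point_in_set)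
    define d where "d = (norm (x - p))\<^sup>2 - (norm (G x - p))\<^sup>2"
    have d0: "0 \<le> d" unfolding d_def using controls_fejer[OF G p] .
    obtain w where w: "w \<in> F" "norm (x - w) \<le> B * (\<Sum>R\<in>J. norm (R x - x))" using B(2) by blast
    have "norm (x - p) \<le> norm (x - w)"
      using closest_point_le[OF cF(2) w(1), of x] by (simp add: p_def dist_norm)
    also note w(2)
    \<comment> \<open>The control bound at \<open>z = p\<close> makes each displacement at most
      \<open>sqrt (K * d)\<close>, turning the error bound into an estimate by the decrease
      \<open>d\<close>.\<close>
    also have "B * (\<Sum>R\<in>J. norm (R x - x)) \<le> B * (\<Sum>R\<in>J. sqrt (K * d))"
      using K(2)[OF p] B(1) by (intro mult_left_mono sum_mono real_le_rsqrt) (auto simp: d_def)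
    finally have "norm (x - p) \<le> B * (card J * sqrt (K * d))" by simp
    then have "(norm (x - p))\<^sup>2 \<le> (B * (card J * sqrt (K * d)))\<^sup>2" by (rule power_mono) simp
    also have "\<dots> = (M - 1) * d"
      using K(1) d0 by (simp add: power_mult_distrib M_def)
    also have "\<dots> \<le> M * d" using d0 by (simp add: algebra_simps)
    \<comment> \<open>Since \<open>d\<close> is the difference of the squared distances, dividing by
      \<open>M\<close> and rearranging yields the contraction factor.\<close>
    finally have "(norm (G x - p))\<^sup>2 \<le> (1 - 1 / M) * (norm (x - p))\<^sup>2"
      using M1 by (simp add: d_def field_simps)
    also have "\<dots> = (\<gamma> * norm (x - p))\<^sup>2"
      using M1 by (simp add: \<gamma>_def power_mult_distrib)
    finally show ?thesis
      unfolding p_def[symmetric] using \<gamma>(1) by (simp add: power2_le_iff_abs_le)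
  qed
  show thesis
  proof (rule that)
    show "BAM_with \<gamma> G"
      unfolding BAM_with_def Fix_controls[OF F G] using \<gamma> cF F(2) pG contr by auto
    \<comment> \<open>All iterates share one projection, so the one-step contraction applies
      repeatedly about the same point.\<close>
    have pk: "closest_point F ((G ^^ k) x) = closest_point F x" for x k
      by (induction k) (auto simp: pG)
    show "norm ((G ^^ k) x - closest_point F x) \<le> \<gamma> ^ k * norm (x - closest_point F x)" for x k
    proof (induction k)
      case (Suc k)
      have "norm ((G ^^ Suc k) x - closest_point F x) \<le> \<gamma> * norm ((G ^^ k) x - closest_point F x)"
        using contr[of "(G ^^ k) x"] by (simp add: pk)
      also have "\<dots> \<le> \<gamma> * (\<gamma> ^ k * norm (x - closest_point F x))"
        using Suc \<gamma> by (intro mult_left_mono) auto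
      finally show ?case by (simp add: mult.assoc)
    qed simp
  qed
qed

section \<open>Assembling the blocks\<close>

lemma UN_consecutive_blocks:
  fixes q :: "nat \<Rightarrow> nat"
  assumes "q 0 = 0" and step: "\<And>i. i \<in> {1..t} \<Longrightarrow> q (i - 1) \<le> q i"
  shows "(\<Union>i\<in>{1..t}. {q (i - 1) + 1..q i}) = {1..q t}"
  using step
proof (induction t)
  case 0
  then show ?case using assms(1) by simp
next
  case (Suc t)
  have "(\<Union>i\<in>{1..t}. {q (i - 1) + 1..q i}) = {1..q t}" using Suc by auto
  moreover have "q t \<le> q (Suc t)" using Suc.prems[of "Suc t"] by simp
  ultimately show ?case by (auto simp: atLeastAtMostSuc_conv)
qed

theorem theorem6p26:
  fixes T :: "nat \<Rightarrow> real ^ 'n \<Rightarrow> real ^ 'n"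
    and m t :: nat
    and q :: "nat \<Rightarrow> nat"
    and S :: "nat \<Rightarrow> (real ^ 'n \<Rightarrow> real ^ 'n) set"
    and G :: "real ^ 'n \<Rightarrow> real ^ 'n"
  assumes "m \<ge> 1"
    and "\<And>i. i \<in> {1..m} \<Longrightarrow> affine_isometry (T i)"
    and "(\<Inter>i\<in>{1..m}. Fix (T i)) \<noteq> {}"
    and "t \<ge> 1"
    and "q 0 = 0"
    and "q t = m"
    and "\<And>i. i \<in> {1..t} \<Longrightarrow> q i \<ge> q (i - 1) + 1"
    and "\<And>i. i \<in> {1..t} \<Longrightarrow> S i = {id} \<union> T ` {q (i - 1) + 1..q i}"
    and "G = fold (\<lambda>i F. CC (S i) \<circ> F) [1..<t + 1] id
         \<or> (\<exists>\<omega> :: nat \<Rightarrow> real. (\<forall>i\<in>{1..t}. 0 < \<omega> i \<and> \<omega> i \<le> 1)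
              \<and> (\<Sum>i=1..t. \<omega> i) = 1
              \<and> G = (\<lambda>x. \<Sum>i=1..t. \<omega> i *\<^sub>R CC (S i) x))"
  shows "Fix G = (\<Inter>i\<in>{1..m}. Fix (T i))
         \<and> BAM G
         \<and> (\<exists>\<gamma>::real. 0 \<le> \<gamma> \<and> \<gamma> < 1 \<and>
              (\<forall>x. \<forall>k::nat.
                 norm ((G ^^ k) x - closest_point (\<Inter>i\<in>{1..m}. Fix (T i)) x)
                 \<le> \<gamma> ^ k * norm (x - closest_point (\<Inter>i\<in>{1..m}. Fix (T i)) x)))"
proof -
  let ?J = "\<Union>i\<in>{1..t}. S i"
  define F where "F = (\<Inter>i\<in>{1..m}. Fix (T i))"
  have "(\<Union>i\<in>{1..t}. {q (i - 1) + 1..q i}) = {1..m}"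
    using UN_consecutive_blocks[of q t] assms(5,6,7) add_leD1 by metis
  \<comment> \<open>\<open>t \<ge> 1\<close> places \<open>id\<close> in the union; as
    \<open>id\<close> fixes every point, it leaves the intersection of fixed point sets
    unchanged.\<close>
  then have J: "?J = insert id (T ` {1..m})"
    using assms(4,8) by (auto simp flip: image_UN)
  have affJ: "affine_isometry R" if "R \<in> ?J" for R
    using that assms(2) unfolding J
    by (auto simp: affine_isometry_def affine_map_def isometry_def)
  have F: "F = (\<Inter>R\<in>?J. Fix R)"
    unfolding J F_def by (auto simp: Fix_def)
  have finJ: "finite ?J" unfolding J by simp
  have iso: "isometry R" if "i \<in> {1..t}" "R \<in> S i" for i R
    using affJ[of R] that unfolding affine_isometry_def by blast
  have CC: "controls F (S i) (CC (S i))" if "i \<in> {1..t}" for i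
  proof (rule controls_CC)
    show "finite (S i)" "id \<in> S i" using assms(8)[OF that] by auto
    show "R z = z" if "R \<in> S i" "z \<in> F" for R z
      using that \<open>i \<in> {1..t}\<close> unfolding F Fix_def by blast
  qed (use iso that in blast)
  have G: "controls F ?J G"
    using assms(9)
  proof (elim disjE exE conjE)
    assume "G = fold (\<lambda>i F. CC (S i) \<circ> F) [1..<t + 1] id"
    moreover have "set [1..<t + 1] = {1..t}" by auto
    ultimately show ?thesis
      using controls_fold_comp[of "[1..<t + 1]" F S "\<lambda>i. CC (S i)"] CC iso by metis
  next
    fix \<omega> :: "nat \<Rightarrow> real"
    assume "\<forall>i\<in>{1..t}. 0 < \<omega> i \<and> \<omega> i \<le> 1" "(\<Sum>i=1..t. \<omega> i) = 1"
      and "G = (\<lambda>x. \<Sum>i=1..t. \<omega> i *\<^sub>R CC (S i) x)"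
    then show ?thesis
      using controls_convex_combination[of "{1..t}" F S "\<lambda>i. CC (S i)" \<omega>] CC by simp
  qed
  have ne: "F \<noteq> {}" using assms(3) by (simp add: F_def)
  obtain \<gamma> where \<gamma>: "BAM_with \<gamma> G"
    "\<And>x k. norm ((G ^^ k) x - closest_point F x) \<le> \<gamma> ^ k * norm (x - closest_point F x)"
    using controls_linear_rate[OF finJ affJ F ne G] by blast
  then have "0 \<le> \<gamma>" "\<gamma> < 1" by (auto simp: BAM_with_def)
  then show ?thesis
    unfolding F_def[symmetric] BAM_def using Fix_controls[OF F ne G] \<gamma> by blast
qed

end
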